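(* Fix a coefficient-free cluster pattern on $\mathbb{T}_n$, and for each vertex $s$ of $\mathbb{T}_n$ let $B_s$ denote its exchange matrix at $s$ (so that for every pair of vertices $s,t$ one has $B_t=B_t^{B_s;s}$). The following three conditions are equivalent. (1) (Property D) For all vertices $t_0,t$ of $\mathbb{T}_n$: $\bigl(D_t^{B_{t_0};t_0}\bigr)^T=D_{t_0}^{(-B_t)^T;t}$. (2) (Property R) For all vertices $t_0,t$ and every $k\in\{1,\dots,n\}$, letting $t_1$ be the vertex with $t_0\overset{k}{-}t_1$ (so $B_{t_1}=\mu_k(B_{t_0})$): $$D_t^{B_{t_1};t_1}=J_kD_t^{B_{t_0};t_0}+\max\Bigl([B_{t_0}^{k\bullet}]_+D_t^{B_{t_0};t_0},\ [-B_{t_0}^{k\bullet}]_+D_t^{B_{t_0};t_0}\Bigr).$$ (3) (Property M) For all vertices $t_0,t$: $$M_t^{B_{t_0};t_0}=-D_t^{B_{t_0};t_0}+\max\Bigl([B_{t_0}]_+D_t^{B_{t_0};t_0},\ [-B_{t_0}]_+D_t^{B_{t_0};t_0}\Bigr).$$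
   Context: $\mathbb{T}_n$ is the $n$-regular tree whose edges are labeled by $1,\dots,n$ so that the $n$ edges at each vertex have distinct labels; $t\overset{k}{-}t'$ means $t,t'$ are joined by an edge labeled $k$. Write $[a]_+=\max(a,0)$. For a skew-symmetrizable integer $n\times n$ matrix $B=(b_{ij})$ and $k\in\{1,\dots,n\}$, the mutation $\mu_k(B)=(b'_{ij})$ is given by $b'_{ij}=-b_{ij}$ if $i=k$ or $j=k$, and $b'_{ij}=b_{ij}+\mathrm{sgn}(b_{ik})[b_{ik}b_{kj}]_+$ otherwise. Given a skew-symmetrizable integer matrix $B_0$ and a vertex $t_0$, the coefficient-free cluster pattern with initial seed $(B_0,(x_1,\dots,x_n))$ at $t_0$ assigns to every vertex $t$ an exchange matrix $B_t^{B_0;t_0}=(b_{ij;t})$ and a cluster $(x_{1;t}^{B_0;t_0},\dots,x_{n;t}^{B_0;t_0})$ of elements of $\mathbb{Q}(x_1,\dots,x_n)$, determined by: $B_{t_0}^{B_0;t_0}=B_0$, $x_{i;t_0}=x_i$, and for each edge $t\overset{k}{-}t'$: $B_{t'}=\mu_k(B_t)$, $x_{j;t'}=x_{j;t}$ for $j\neq k$, and $x_{k;t'}x_{k;t}=\prod_\ell x_{\ell;t}^{[b_{\ell k;t}]_+}+\prod_\ell x_{\ell;t}^{[-b_{\ell k;t}]_+}$. Each $x_{j;t}^{B_0;t_0}$ is a Laurent polynomial in $x_1,\dots,x_n$. $D_t^{B_0;t_0}$ is the $n\times n$ integer matrix whose $(i,j)$ entry is the negative of the lowest power of $x_i$ occurring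 in a monomial of the Laurent expansion of $x_{j;t}^{B_0;t_0}$ (its $j$-th column is the denominator vector, or $\mathbf{d}$-vector, of $x_{j;t}^{B_0;t_0}$); these matrices depend only on $B_0,t_0,t$. $M_t^{B_0;t_0}$ is the $n\times n$ matrix whose $(i,j)$ entry is the highest power of $x_i$ occurring in a monomial of the Laurent expansion of $x_{j;t}^{B_0;t_0}$. For a matrix $A$, $A^{k\bullet}$ is obtained from $A$ by replacing all entries outside the $k$-th row by $0$. $J_k$ is the identity matrix with its $(k,k)$ entry replaced by $-1$. The operations $\max$ and $[\cdot]_+$ are applied entrywise to matrices; $T$ denotes transpose. *)

theory Defs
  imports
    "HOL-Analysis.Finite_Cartesian_Product"
    "HOL-Library.Poly_Mapping"
    "HOL-Computational_Algebra.Fraction_Field"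
begin

(* The index set {1,...,n} is a finite linearly ordered type 'n.  The order plays no role in the
   mathematics: the library needs it to see that polynomials over 'n form an integral domain. *)

section \<open>The labelled regular tree\<close>

(* The n-regular tree, rooted at the empty word: its vertices are the words in the labels without
   two equal consecutive letters, and every nonempty word k # w is joined to its parent w by an
   edge labelled k. *)

typedef 'n tree_vertex = "{w :: 'n list. distinct_adj w}"
  morphisms word_of vertex_of
  by (rule exI[of _ "[]"]) simp

definition linked :: "'n \<Rightarrow> 'n tree_vertex \<Rightarrow> 'n tree_vertex \<Rightarrow> bool" where
  "linked k t t' \<longleftrightarrow> word_of t' = k # word_of t \<or> word_of t = k # word_of t'"

lemma linked_sym: "linked k t t' \<longleftrightarrow> linked k t' t"
  by (auto simp: linked_def)

lemma linked_ex1: "\<exists>!t'. linked k t t'"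
proof -
  have reduced: "distinct_adj (word_of t)"
    using word_of[of t] by simp
  show ?thesis
  proof (cases "\<exists>w. word_of t = k # w")
    case True
    then obtain w where w: "word_of t = k # w" by blast
    with reduced have "distinct_adj w" "distinct_adj (k # w)"
      by (auto simp: distinct_adj_Cons)
    then have "word_of (vertex_of w) = w" by (simp add: vertex_of_inverse)
    moreover have "word_of t' \<noteq> k # k # w" for t' :: "'a tree_vertex"
      using word_of[of t'] by auto
    ultimately show ?thesis
      by (intro ex1I[of _ "vertex_of w"]) (auto simp: linked_def w word_of_inject[symmetric])
  next
    case False
    with reduced have "distinct_adj (k # word_of t)"
      by (cases "word_of t") auto
    then have "word_of (vertex_of (k # word_of t)) = k # word_of t"
      by (simp add: vertex_of_inverse)
    with False show ?thesis
      by (intro ex1I[of _ "vertex_of (k # word_of t)"])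
        (auto simp: linked_def word_of_inject[symmetric])
  qed
qed

lemma linked_label_unique: "linked k t t' \<Longrightarrow> linked l t t' \<Longrightarrow> k = l"
  by (auto simp: linked_def)


section \<open>Exchange matrices\<close>

type_synonym 'n int_matrix = "int ^ 'n ^ 'n"

definition skew_symmetrizable :: "'n::finite int_matrix \<Rightarrow> bool" where
  "skew_symmetrizable B \<longleftrightarrow>
     (\<exists>d :: 'n \<Rightarrow> int. (\<forall>i. d i > 0) \<and> (\<forall>i j. d i * B $ i $ j = - (d j * B $ j $ i)))"

definition matrix_mutation :: "'n::finite \<Rightarrow> 'n int_matrix \<Rightarrow> 'n int_matrix" where
  "matrix_mutation k B =
     (\<chi> i j. if i = k \<or> j = k then - B $ i $ j
             else B $ i $ j + sgn (B $ i $ k) * max (B $ i $ k * B $ k $ j) 0)"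


section \<open>Rational functions and Laurent polynomials\<close>

(* The field Q(x_i : i in 'n), and Laurent polynomials in the x_i with rational coefficients. *)

type_synonym 'n ratfun = "(('n \<Rightarrow>\<^sub>0 nat) \<Rightarrow>\<^sub>0 rat) fract"
type_synonym 'n laurent = "('n \<Rightarrow>\<^sub>0 int) \<Rightarrow>\<^sub>0 rat"

definition rf_const :: "rat \<Rightarrow> 'n::{finite, linorder} ratfun" where
  "rf_const c = Fract (Poly_Mapping.single 0 c) 1"

definition rf_var :: "'n::{finite, linorder} \<Rightarrow> 'n ratfun" where
  "rf_var i = Fract (Poly_Mapping.single (Poly_Mapping.single i 1) 1) 1"

definition laurent_value :: "'n::{finite, linorder} laurent \<Rightarrow> 'n ratfun" where
  "laurent_value p =
     (\<Sum>m\<in>Poly_Mapping.keys p.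
        rf_const (Poly_Mapping.lookup p m) * (\<Prod>i\<in>UNIV. rf_var i powi Poly_Mapping.lookup m i))"

definition laurent_expansion :: "'n::{finite, linorder} ratfun \<Rightarrow> 'n laurent" where
  "laurent_expansion f = (THE p. laurent_value p = f)"

definition laurent_low :: "'n \<Rightarrow> 'n laurent \<Rightarrow> int" where
  "laurent_low i p = Min ((\<lambda>m. Poly_Mapping.lookup m i) ` Poly_Mapping.keys p)"

definition laurent_high :: "'n \<Rightarrow> 'n laurent \<Rightarrow> int" where
  "laurent_high i p = Max ((\<lambda>m. Poly_Mapping.lookup m i) ` Poly_Mapping.keys p)"

(* Lowest and highest power of x_i in the Laurent expansion of f.  The else-branches only make
   the functions total: they extend the notion multiplicatively to quotients of Laurent
   polynomials, and are never taken for cluster variables, by the Laurent phenomenon. *)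

definition lowest_power :: "'n::{finite, linorder} \<Rightarrow> 'n ratfun \<Rightarrow> int" where
  "lowest_power i f =
     (if f \<in> range laurent_value then laurent_low i (laurent_expansion f)
      else (THE d. \<exists>p q. p \<noteq> 0 \<and> q \<noteq> 0 \<and> f = laurent_value p / laurent_value q
                         \<and> d = laurent_low i p - laurent_low i q))"

definition highest_power :: "'n::{finite, linorder} \<Rightarrow> 'n ratfun \<Rightarrow> int" where
  "highest_power i f =
     (if f \<in> range laurent_value then laurent_high i (laurent_expansion f)
      else (THE d. \<exists>p q. p \<noteq> 0 \<and> q \<noteq> 0 \<and> f = laurent_value p / laurent_value q
                         \<and> d = laurent_high i p - laurent_high i q))"


section \<open>Cluster patterns\<close>

(* B t and x t are the exchange matrix and the cluster at t of the coefficient-free cluster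
   pattern with initial seed (B0, (x_i)) at t0. *)

definition is_cluster_pattern ::
  "'n int_matrix \<Rightarrow> 'n::{finite, linorder} tree_vertex \<Rightarrow>
     ('n tree_vertex \<Rightarrow> 'n int_matrix) \<Rightarrow> ('n tree_vertex \<Rightarrow> 'n \<Rightarrow> 'n ratfun) \<Rightarrow> bool" where
  "is_cluster_pattern B0 t0 B x \<longleftrightarrow>
     B t0 = B0 \<and> (\<forall>i. x t0 i = rf_var i) \<and>
     (\<forall>k t t'. linked k t t' \<longrightarrow>
        B t' = matrix_mutation k (B t) \<and>
        (\<forall>j. j \<noteq> k \<longrightarrow> x t' j = x t j) \<and>
        x t' k * x t k =
          (\<Prod>l\<in>UNIV. x t l ^ nat (max (B t $ l $ k) 0)) +
          (\<Prod>l\<in>UNIV. x t l ^ nat (max (- B t $ l $ k) 0)))"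

definition cluster_pattern ::
  "'n int_matrix \<Rightarrow> 'n::{finite, linorder} tree_vertex \<Rightarrow>
     ('n tree_vertex \<Rightarrow> 'n int_matrix) \<times> ('n tree_vertex \<Rightarrow> 'n \<Rightarrow> 'n ratfun)" where
  "cluster_pattern B0 t0 = (THE P. is_cluster_pattern B0 t0 (fst P) (snd P))"

definition exchange_matrix ::
  "'n int_matrix \<Rightarrow> 'n::{finite, linorder} tree_vertex \<Rightarrow> 'n tree_vertex \<Rightarrow> 'n int_matrix" where
  "exchange_matrix B0 t0 t = fst (cluster_pattern B0 t0) t"

definition cluster_variable ::
  "'n int_matrix \<Rightarrow> 'n::{finite, linorder} tree_vertex \<Rightarrow> 'n tree_vertex \<Rightarrow> 'n \<Rightarrow> 'n ratfun" where
  "cluster_variable B0 t0 t j = snd (cluster_pattern B0 t0) t j"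

definition D_matrix ::
  "'n int_matrix \<Rightarrow> 'n::{finite, linorder} tree_vertex \<Rightarrow> 'n tree_vertex \<Rightarrow> 'n int_matrix" where
  "D_matrix B0 t0 t = (\<chi> i j. - lowest_power i (cluster_variable B0 t0 t j))"

definition M_matrix ::
  "'n int_matrix \<Rightarrow> 'n::{finite, linorder} tree_vertex \<Rightarrow> 'n tree_vertex \<Rightarrow> 'n int_matrix" where
  "M_matrix B0 t0 t = (\<chi> i j. highest_power i (cluster_variable B0 t0 t j))"


section \<open>The three properties\<close>

definition mat_max :: "'n::finite int_matrix \<Rightarrow> 'n int_matrix \<Rightarrow> 'n int_matrix" where
  "mat_max A C = (\<chi> i j. max (A $ i $ j) (C $ i $ j))"

definition mat_pos :: "'n::finite int_matrix \<Rightarrow> 'n int_matrix" where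
  "mat_pos A = (\<chi> i j. max (A $ i $ j) 0)"

definition row_part :: "'n::finite \<Rightarrow> 'n int_matrix \<Rightarrow> 'n int_matrix" where
  "row_part k A = (\<chi> i j. if i = k then A $ i $ j else 0)"

definition J_matrix :: "'n::finite \<Rightarrow> 'n int_matrix" where
  "J_matrix k = (\<chi> i j. if i = j then (if i = k then - 1 else 1) else 0)"

(* In the following, B assigns to each vertex its exchange matrix in a fixed cluster pattern. *)

definition property_D :: "('n::{finite, linorder} tree_vertex \<Rightarrow> 'n int_matrix) \<Rightarrow> bool" where
  "property_D B \<longleftrightarrow>
     (\<forall>t0 t. transpose (D_matrix (B t0) t0 t) = D_matrix (transpose (- B t)) t t0)"

definition property_R :: "('n::{finite, linorder} tree_vertex \<Rightarrow> 'n int_matrix) \<Rightarrow> bool" where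
  "property_R B \<longleftrightarrow>
     (\<forall>t0 t k t1. linked k t0 t1 \<longrightarrow>
        D_matrix (B t1) t1 t =
          J_matrix k ** D_matrix (B t0) t0 t +
          mat_max (mat_pos (row_part k (B t0)) ** D_matrix (B t0) t0 t)
                  (mat_pos (- row_part k (B t0)) ** D_matrix (B t0) t0 t))"

definition property_M :: "('n::{finite, linorder} tree_vertex \<Rightarrow> 'n int_matrix) \<Rightarrow> bool" where
  "property_M B \<longleftrightarrow>
     (\<forall>t0 t.
        M_matrix (B t0) t0 t =
          - D_matrix (B t0) t0 t +
          mat_max (mat_pos (B t0) ** D_matrix (B t0) t0 t)
                  (mat_pos (- B t0) ** D_matrix (B t0) t0 t))"

end

theory Submission
  imports Defs
begin

text \<open>The lowest power of \<open>x\<^sub>i\<close>, and minus the highest one, are valuations on the field of rational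
  functions which take sums of subtraction-free elements to minima.  Cluster variables are
  subtraction-free, so both valuations turn the exchange relations into one tropical recursion in
  the final vertex, which is determined by its values at any single vertex.  Comparing such
  recursions at the vertex \<open>t\<^sub>1\<close> that is joined by an edge \<open>k\<close> to \<open>t\<^sub>0\<close> shows that the \<open>D\<close>-matrices
  for the initial vertices \<open>t\<^sub>0\<close> and \<open>t\<^sub>1\<close> agree outside row \<open>k\<close>, and that row \<open>k\<close> of the latter is
  row \<open>k\<close> of the \<open>M\<close>-matrix for \<open>t\<^sub>0\<close>.  Hence R and M are the same condition.  Property R says that
  the rows of the \<open>D\<close>-matrices satisfy, in the initial vertex, the tropical recursion of the pattern
  of the matrices \<open>-B\<^sup>T\<close>; the transposed matrices in property D always do, with the same values at
  \<open>t\<^sub>0 = t\<close>, so R and D are equivalent by uniqueness.\<close>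

section \<open>Laurent polynomials as rational functions\<close>

abbreviation monomial_value :: "('n::{finite, linorder} \<Rightarrow>\<^sub>0 int) \<Rightarrow> 'n ratfun" where
  "monomial_value m \<equiv> \<Prod>i\<in>UNIV. rf_var i powi Poly_Mapping.lookup m i"

lemma poly_mapping_sum_single:
  "p = (\<Sum>m\<in>Poly_Mapping.keys p. Poly_Mapping.single m (Poly_Mapping.lookup p m))"
  by (rule poly_mapping_eqI)
    (auto simp: lookup_sum lookup_single when_def sum.delta in_keys_iff)

lemma rf_const_0 [simp]: "rf_const 0 = 0"
  by (simp add: rf_const_def Zero_fract_def)

lemma rf_const_1 [simp]: "rf_const 1 = 1"
  by (simp add: rf_const_def One_fract_def)

lemma rf_const_add: "rf_const (a + b) = rf_const a + rf_const b"
  by (simp add: rf_const_def single_add)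

lemma rf_const_mult: "rf_const (a * b) = rf_const a * rf_const b"
  by (simp add: rf_const_def mult_single)

lemma rf_var_nonzero [simp]: "rf_var i \<noteq> 0"
  by (simp add: rf_var_def Zero_fract_def eq_fract single_zero)
    (metis lookup_single_eq lookup_zero zero_neq_one)

lemma monomial_value_add: "monomial_value (m + m') = monomial_value m * monomial_value m'"
  by (simp add: lookup_add power_int_add prod.distrib)

lemma laurent_value_0 [simp]: "laurent_value 0 = 0"
  by (simp add: laurent_value_def)

lemma laurent_value_single [simp]:
  "laurent_value (Poly_Mapping.single m c) = rf_const c * monomial_value m"
  by (simp add: laurent_value_def)

lemma laurent_value_1 [simp]: "laurent_value 1 = 1"
  by (simp add: laurent_value_def)

lemma laurent_value_add [simp]: "laurent_value (p + q) = laurent_value p + laurent_value q"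
  unfolding laurent_value_def
  by (rule setsum_keys_plus_distrib) (simp_all add: rf_const_add distrib_right)

lemma rf_var_eq_laurent_value:
  "rf_var i = laurent_value (Poly_Mapping.single (Poly_Mapping.single i 1) 1)"
proof -
  have "monomial_value (Poly_Mapping.single i 1) = (\<Prod>j\<in>UNIV. if i = j then rf_var j else 1)"
    by (intro prod.cong) (simp_all add: lookup_single)
  then show ?thesis by simp
qed

lemma laurent_value_sum: "laurent_value (sum f A) = (\<Sum>a\<in>A. laurent_value (f a))"
  by (induction A rule: infinite_finite_induct) auto

lemma laurent_value_mult [simp]: "laurent_value (p * q) = laurent_value p * laurent_value q"
proof -
  have "laurent_value (p * q) =
      laurent_value ((\<Sum>m\<in>Poly_Mapping.keys p. Poly_Mapping.single m (Poly_Mapping.lookup p m)) *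
        (\<Sum>m\<in>Poly_Mapping.keys q. Poly_Mapping.single m (Poly_Mapping.lookup q m)))"
    by (simp only: poly_mapping_sum_single[symmetric])
  also have "\<dots> = laurent_value p * laurent_value q"
    by (simp add: sum_product mult_single laurent_value_sum rf_const_mult monomial_value_add
        laurent_value_def[of p] laurent_value_def[of q] ac_simps)
  finally show ?thesis .
qed

lemma prod_rf_var_power:
  fixes e :: "'n::{finite, linorder} \<Rightarrow>\<^sub>0 nat"
  shows "(\<Prod>i\<in>UNIV. rf_var i ^ Poly_Mapping.lookup e i) = Fract (Poly_Mapping.single e 1) 1"
proof -
  have pow: "rf_var i ^ k = Fract (Poly_Mapping.single (Poly_Mapping.single i k) 1) 1"
    for i :: 'n and k
    by (induction k) (simp_all add: rf_var_def mult_single One_fract_def flip: single_add)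
  have "(\<Prod>i\<in>A. Fract (Poly_Mapping.single (g i) (1::rat)) 1) =
      Fract (Poly_Mapping.single (\<Sum>i\<in>A. g i) 1) 1"
    for A and g :: "'n \<Rightarrow> ('n \<Rightarrow>\<^sub>0 nat)"
    by (induction A rule: infinite_finite_induct) (auto simp: mult_single One_fract_def)
  moreover have "(\<Sum>i\<in>UNIV. Poly_Mapping.single i (Poly_Mapping.lookup e i)) = e"
    by (rule poly_mapping_eqI) (auto simp: lookup_sum lookup_single when_def)
  ultimately show ?thesis
    by (simp add: pow)
qed

lemma Fract_sum: "(\<Sum>a\<in>A. Fract (f a) (1::'b::idom)) = Fract (sum f A) 1"
  by (induction A rule: infinite_finite_induct) (auto simp: Zero_fract_def)

text \<open>Reading the exponents of \<open>a\<close> as integers gives the Laurent polynomial.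
  Numerator and denominator of any rational function are thus Laurent values.\<close>

lemma Fract_in_range_laurent_value: "Fract a 1 \<in> range laurent_value"
proof -
  let ?int = "Poly_Mapping.map int"
  have int: "Poly_Mapping.lookup (?int e) i = int (Poly_Mapping.lookup e i)"
    for e :: "'a \<Rightarrow>\<^sub>0 nat" and i
    by (simp add: Poly_Mapping.map.rep_eq when_def)
  have "laurent_value
          (\<Sum>e\<in>Poly_Mapping.keys a. Poly_Mapping.single (?int e) (Poly_Mapping.lookup a e)) =
        (\<Sum>e\<in>Poly_Mapping.keys a. Fract (Poly_Mapping.single e (Poly_Mapping.lookup a e)) 1)"
    by (simp add: laurent_value_sum int rf_const_def prod_rf_var_power mult_single)
  also have "\<dots> = Fract a 1"
    by (simp add: Fract_sum flip: poly_mapping_sum_single)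
  finally show ?thesis
    by (metis rangeI)
qed

text \<open>Multiplication by a large monomial \<^term>\<open>N\<close> reduces this to ordinary polynomials, where
  distinct exponents stay distinct.\<close>

lemma laurent_value_eq_0_iff [simp]: "laurent_value p = 0 \<longleftrightarrow> p = 0"
proof
  assume "laurent_value p = 0"
  define K where "K = Poly_Mapping.keys p"
  have fin: "finite K" by (simp add: K_def)
  \<comment> \<open>Each exponent of \<open>N\<close> bounds the absolute values of the
    corresponding exponents in \<open>K\<close>, so \<open>m + N\<close> has no negative exponent
    for \<open>m\<close> in \<open>K\<close> and \<open>nat\<close> in \<open>shift\<close> loses
    nothing.\<close>
  define N where "N = (\<Sum>i\<in>UNIV. Poly_Mapping.single i (\<Sum>m\<in>K. \<bar>Poly_Mapping.lookup m i\<bar>))"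
  define shift where "shift m = Poly_Mapping.map nat (m + N)" for m
  have N: "Poly_Mapping.lookup N i = (\<Sum>m\<in>K. \<bar>Poly_Mapping.lookup m i\<bar>)" for i
    by (auto simp: N_def lookup_sum lookup_single when_def)
  have nonneg: "Poly_Mapping.lookup (m + N) i \<ge> 0" if "m \<in> K" for m i
    using member_le_sum[of m K "\<lambda>m. \<bar>Poly_Mapping.lookup m i\<bar>"] that fin
    by (auto simp: lookup_add N)
  have shift: "int (Poly_Mapping.lookup (shift m) i) = Poly_Mapping.lookup (m + N) i"
    if "m \<in> K" for m i
    using nonneg[OF that, of i] by (simp add: shift_def Poly_Mapping.map.rep_eq when_def)
  have inj: "inj_on shift K"
  proof (rule inj_onI, rule poly_mapping_eqI)
    fix m m' i assume "m \<in> K" "m' \<in> K" "shift m = shift m'"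
    then have "Poly_Mapping.lookup (m + N) i = Poly_Mapping.lookup (m' + N) i"
      using shift by metis
    then show "Poly_Mapping.lookup m i = Poly_Mapping.lookup m' i"
      by (simp add: lookup_add)
  qed
  have mon: "monomial_value (m + N) = Fract (Poly_Mapping.single (shift m) 1) 1" if "m \<in> K" for m
    by (simp add: shift[OF that, symmetric] prod_rf_var_power)
  let ?s = "\<Sum>m\<in>K. Poly_Mapping.single (shift m) (Poly_Mapping.lookup p m)"
  have "0 = laurent_value p * monomial_value N"
    using \<open>laurent_value p = 0\<close> by simp
  also have "\<dots> = (\<Sum>m\<in>K. rf_const (Poly_Mapping.lookup p m) * monomial_value (m + N))"
    unfolding laurent_value_def K_def[symmetric] monomial_value_add
    by (simp add: sum_distrib_right mult.assoc)
  also have "\<dots> = (\<Sum>m\<in>K. Fract (Poly_Mapping.single (shift m) (Poly_Mapping.lookup p m)) 1)"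
    using mon by (intro sum.cong) (simp_all add: rf_const_def mult_single)
  also have "\<dots> = Fract ?s 1"
    by (rule Fract_sum)
  finally have "?s = 0"
    by (simp add: Zero_fract_def eq_fract)
  moreover have "Poly_Mapping.lookup ?s (shift m) = Poly_Mapping.lookup p m" if "m \<in> K" for m
  proof -
    \<comment> \<open>By injectivity of \<open>shift\<close> on \<open>K\<close>, only the summand
      of \<open>m\<close> itself reaches this coefficient.\<close>
    have "Poly_Mapping.lookup ?s (shift m) =
        (\<Sum>m'\<in>K. if m' = m then Poly_Mapping.lookup p m' else 0)"
      unfolding lookup_sum
      using inj that by (intro sum.cong) (auto simp: lookup_single when_def inj_on_def)
    then show ?thesis using that fin by simp
  qed
  ultimately have "K = {}"
    by (metis K_def in_keys_iff lookup_zero ex_in_conv)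
  then show "p = 0"
    by (simp add: K_def)
qed simp

lemma laurent_value_inject [simp]: "laurent_value p = laurent_value q \<longleftrightarrow> p = q"
proof
  assume eq: "laurent_value p = laurent_value q"
  have "laurent_value (p - q) + laurent_value q = laurent_value p"
    by (simp flip: laurent_value_add)
  with eq have "laurent_value (p - q) = 0" by simp
  then show "p = q" by simp
qed simp

lemma laurent_quotient:
  obtains p q where "f = laurent_value p / laurent_value q" "q \<noteq> 0"
proof (cases f)
  case (Fract a b)
  obtain p q where pq: "Fract a 1 = laurent_value p" "Fract b 1 = laurent_value q"
    using Fract_in_range_laurent_value by (metis imageE)
  have "f = Fract a 1 / Fract b 1"
    using Fract by simp
  moreover have "Fract b 1 \<noteq> 0"
    using \<open>b \<noteq> 0\<close> by (simp add: Zero_fract_def eq_fract)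
  ultimately show ?thesis
    using that[of p q] pq by auto
qed


section \<open>Monomial valuations\<close>

text \<open>A coordinate as \<open>w\<close> gives the lowest power of that variable, a negated
  coordinate minus the highest one. The value at 0 is the unspecified \<open>Min {}\<close>.\<close>

definition min_weight :: "(('n \<Rightarrow>\<^sub>0 int) \<Rightarrow> int) \<Rightarrow> 'n laurent \<Rightarrow> int" where
  "min_weight w p = Min (w ` Poly_Mapping.keys p)"

lemma min_weight_single [simp]: "c \<noteq> 0 \<Longrightarrow> min_weight w (Poly_Mapping.single m c) = w m"
  by (simp add: min_weight_def)

lemma min_weight_le: "m \<in> Poly_Mapping.keys p \<Longrightarrow> min_weight w p \<le> w m"
  by (simp add: min_weight_def)

lemma min_weight_eqI:
  assumes "m \<in> Poly_Mapping.keys p" "\<And>m'. m' \<in> Poly_Mapping.keys p \<Longrightarrow> w m \<le> w m'"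
  shows "min_weight w p = w m"
  unfolding min_weight_def using assms by (intro Min_eqI) auto

text \<open>\<open>p0\<close> collects the terms of minimal weight; it is nonzero because the
  minimum over the finite support is attained.\<close>

lemma initial_form:
  assumes "p \<noteq> 0"
  obtains p0 p1 where "p = p0 + p1" "p0 \<noteq> 0"
    "\<And>m. m \<in> Poly_Mapping.keys p0 \<Longrightarrow> w m = min_weight w p"
    "\<And>m. m \<in> Poly_Mapping.keys p1 \<Longrightarrow> w m > min_weight w p"
proof -
  define part where
    "part S = (\<Sum>m\<in>S. Poly_Mapping.single m (Poly_Mapping.lookup p m))" for S
  have lookup_part: "Poly_Mapping.lookup (part S) m = (if m \<in> S then Poly_Mapping.lookup p m else 0)"
    if "S \<subseteq> Poly_Mapping.keys p" for S m
    using finite_subset[OF that] by (auto simp: part_def lookup_sum lookup_single when_def)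
  define S0 where "S0 = {m \<in> Poly_Mapping.keys p. w m = min_weight w p}"
  define S1 where "S1 = {m \<in> Poly_Mapping.keys p. w m > min_weight w p}"
  have lookup0: "Poly_Mapping.lookup (part S0) m = (if m \<in> S0 then Poly_Mapping.lookup p m else 0)"
    and lookup1: "Poly_Mapping.lookup (part S1) m = (if m \<in> S1 then Poly_Mapping.lookup p m else 0)"
    for m
    by (rule lookup_part; simp add: S0_def S1_def)+
  show ?thesis
  proof (rule that[of "part S0" "part S1"])
    show "p = part S0 + part S1"
    proof (rule poly_mapping_eqI)
      fix m
      have "m \<in> Poly_Mapping.keys p \<longleftrightarrow> m \<in> S0 \<or> m \<in> S1" "\<not> (m \<in> S0 \<and> m \<in> S1)"
        using min_weight_le[of m p w] by (auto simp: S0_def S1_def)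
      then show "Poly_Mapping.lookup p m = Poly_Mapping.lookup (part S0 + part S1) m"
        by (auto simp: lookup_add lookup0 lookup1 in_keys_iff)
    qed
    have "min_weight w p \<in> w ` Poly_Mapping.keys p"
      unfolding min_weight_def using assms by (intro Min_in) auto
    then obtain m where "m \<in> S0" "m \<in> Poly_Mapping.keys p" by (force simp: S0_def)
    then have "Poly_Mapping.lookup (part S0) m \<noteq> 0"
      by (simp add: lookup0 in_keys_iff)
    then show "part S0 \<noteq> 0" by auto
    show "w m = min_weight w p" if "m \<in> Poly_Mapping.keys (part S0)" for m
    proof -
      have "m \<in> S0"
        using that by (simp add: in_keys_iff lookup0 split: if_splits)
      then show ?thesis by (simp add: S0_def)
    qed
    show "w m > min_weight w p" if "m \<in> Poly_Mapping.keys (part S1)" for m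
    proof -
      have "m \<in> S1"
        using that by (simp add: in_keys_iff lookup1 split: if_splits)
      then show ?thesis by (simp add: S1_def)
    qed
  qed
qed

text \<open>Coefficients may be negative here, so it is the product of the initial forms, nonzero in an
  integral domain, that keeps the lowest terms from cancelling.\<close>

lemma min_weight_mult:
  fixes p q :: "'n::{finite, linorder} laurent"
  assumes w: "Modules.additive w" and "p \<noteq> 0" "q \<noteq> 0"
  shows "min_weight w (p * q) = min_weight w p + min_weight w q"
proof -
  obtain p0 p1 where p: "p = p0 + p1" "p0 \<noteq> 0"
    "\<And>m. m \<in> Poly_Mapping.keys p0 \<Longrightarrow> w m = min_weight w p"
    "\<And>m. m \<in> Poly_Mapping.keys p1 \<Longrightarrow> w m > min_weight w p"
    by (rule initial_form[OF \<open>p \<noteq> 0\<close>, of w]) blast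
  obtain q0 q1 where q: "q = q0 + q1" "q0 \<noteq> 0"
    "\<And>m. m \<in> Poly_Mapping.keys q0 \<Longrightarrow> w m = min_weight w q"
    "\<And>m. m \<in> Poly_Mapping.keys q1 \<Longrightarrow> w m > min_weight w q"
    by (rule initial_form[OF \<open>q \<noteq> 0\<close>, of w]) blast
  let ?d = "min_weight w p + min_weight w q"
  let ?rest = "p0 * q1 + p1 * q"
  have pq: "p * q = p0 * q0 + ?rest"
    unfolding p(1) by (simp add: q(1) algebra_simps)
  have add: "w (a + b) = w a + w b" for a b
    using w by (rule additive.add)
  have init: "w m = ?d" if m: "m \<in> Poly_Mapping.keys (p0 * q0)" for m
  proof -
    obtain a b where "m = a + b" "a \<in> Poly_Mapping.keys p0" "b \<in> Poly_Mapping.keys q0"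
      using m keys_mult[of p0 q0] by blast
    then show ?thesis using p(3)[of a] q(3)[of b] by (simp add: add)
  qed
  have rest: "w m > ?d" if m: "m \<in> Poly_Mapping.keys ?rest" for m
  proof -
    consider "m \<in> Poly_Mapping.keys (p0 * q1)" | "m \<in> Poly_Mapping.keys (p1 * q)"
      using m keys_add[of "p0 * q1" "p1 * q"] by blast
    then show ?thesis
    proof cases
      case 1
      then obtain a b where "m = a + b" "a \<in> Poly_Mapping.keys p0" "b \<in> Poly_Mapping.keys q1"
        using keys_mult[of p0 q1] by blast
      then show ?thesis using p(3)[of a] q(4)[of b] by (simp add: add)
    next
      case 2
      then obtain a b where "m = a + b" "a \<in> Poly_Mapping.keys p1" "b \<in> Poly_Mapping.keys q"
        using keys_mult[of p1 q] by blast
      then show ?thesis using p(4)[of a] min_weight_le[of b q w] by (simp add: add)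
    qed
  qed
  have "p0 * q0 \<noteq> 0"
    using p(2) q(2) by simp
  then obtain m where m: "m \<in> Poly_Mapping.keys (p0 * q0)"
    by (metis ex_in_conv keys_eq_empty)
  \<comment> \<open>The remaining products only contain monomials of strictly larger weight, so none
    of them can cancel the term at \<open>m\<close>.\<close>
  have "m \<notin> Poly_Mapping.keys ?rest"
    using init[OF m] rest[of m] by auto
  then have "Poly_Mapping.lookup (p * q) m = Poly_Mapping.lookup (p0 * q0) m"
    unfolding pq lookup_add[of "p0 * q0"] by (metis add.right_neutral in_keys_iff)
  then have "m \<in> Poly_Mapping.keys (p * q)"
    using m by (simp add: in_keys_iff)
  then have "min_weight w (p * q) = w m"
  proof (rule min_weight_eqI)
    fix m' assume "m' \<in> Poly_Mapping.keys (p * q)"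
    then have "m' \<in> Poly_Mapping.keys (p0 * q0) \<union> Poly_Mapping.keys ?rest"
      unfolding pq using keys_add[of "p0 * q0" ?rest] by blast
    then show "w m \<le> w m'"
      using init[of m'] init[OF m] rest[of m'] by (metis Un_iff less_imp_le order_refl)
  qed
  with init[OF m] show ?thesis by simp
qed

text \<open>The extension of \<open>min_weight\<close> to quotients, shaped like the default branch
  of \<open>lowest_power\<close>. At 0 no pair \<open>p\<close>, \<open>q\<close> qualifies, so the
  value there is unspecified.\<close>

definition weight_val :: "(('n \<Rightarrow>\<^sub>0 int) \<Rightarrow> int) \<Rightarrow> 'n::{finite, linorder} ratfun \<Rightarrow> int" where
  "weight_val w f =
     (THE d. \<exists>p q. p \<noteq> 0 \<and> q \<noteq> 0 \<and> f = laurent_value p / laurent_value q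
                   \<and> d = min_weight w p - min_weight w q)"

text \<open>Independence of the representation: cross-multiplying two equal quotients gives equal
  Laurent polynomials, and \<open>min_weight\<close> is additive on products.\<close>

lemma weight_val_quotient:
  assumes w: "Modules.additive w" and "p \<noteq> 0" "q \<noteq> 0"
  shows "weight_val w (laurent_value p / laurent_value q) = min_weight w p - min_weight w q"
  unfolding weight_val_def
proof (rule the_equality)
  fix d
  assume "\<exists>p' q'. p' \<noteq> 0 \<and> q' \<noteq> 0 \<and>
    laurent_value p / laurent_value q = laurent_value p' / laurent_value q' \<and>
    d = min_weight w p' - min_weight w q'"
  then obtain p' q' where nz: "p' \<noteq> 0" "q' \<noteq> 0"
    and eq: "laurent_value p / laurent_value q = laurent_value p' / laurent_value q'"
    and d: "d = min_weight w p' - min_weight w q'"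
    by blast
  from eq nz assms have "laurent_value (p * q') = laurent_value (p' * q)"
    by (simp add: field_simps)
  then have "p * q' = p' * q"
    by (simp only: laurent_value_inject)
  then have "min_weight w (p * q') = min_weight w (p' * q)"
    by simp
  then show "d = min_weight w p - min_weight w q"
    using nz assms by (simp add: d min_weight_mult)
qed (use assms in blast)

lemma nonzero_laurent_quotient:
  assumes "f \<noteq> 0"
  obtains p q where "f = laurent_value p / laurent_value q" "p \<noteq> 0" "q \<noteq> 0"
  using laurent_quotient[of f] assms by (metis div_0 laurent_value_0)

lemma weight_val_laurent:
  assumes "Modules.additive w" "p \<noteq> 0"
  shows "weight_val w (laurent_value p) = min_weight w p"
proof -
  have "w 0 = 0"
    using assms(1) by (rule additive.zero)
  then show ?thesis
    using weight_val_quotient[OF assms, of 1] by (simp add: min_weight_def)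
qed

lemma weight_val_mult:
  assumes w: "Modules.additive w" and "f \<noteq> 0" "g \<noteq> 0"
  shows "weight_val w (f * g) = weight_val w f + weight_val w g"
proof -
  obtain p q where f: "f = laurent_value p / laurent_value q" "p \<noteq> 0" "q \<noteq> 0"
    using \<open>f \<noteq> 0\<close> by (rule nonzero_laurent_quotient)
  obtain p' q' where g: "g = laurent_value p' / laurent_value q'" "p' \<noteq> 0" "q' \<noteq> 0"
    using \<open>g \<noteq> 0\<close> by (rule nonzero_laurent_quotient)
  have "f * g = laurent_value (p * p') / laurent_value (q * q')"
    by (simp add: f g)
  also have "weight_val w \<dots> = min_weight w (p * p') - min_weight w (q * q')"
    using w f g by (intro weight_val_quotient) simp_all
  also have "\<dots> = weight_val w f + weight_val w g"
    using f g by (simp add: weight_val_quotient[OF w] min_weight_mult[OF w])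
  finally show ?thesis .
qed

lemma weight_val_1: "Modules.additive w \<Longrightarrow> weight_val w 1 = 0"
  using weight_val_laurent[of w 1] additive.zero[of w] by (simp add: min_weight_def)

lemma weight_val_power:
  assumes "Modules.additive w" "f \<noteq> 0"
  shows "weight_val w (f ^ k) = int k * weight_val w f"
  by (induction k) (simp_all add: assms weight_val_1 weight_val_mult algebra_simps)

lemma weight_val_prod:
  assumes w: "Modules.additive w" and nz: "\<And>a. a \<in> A \<Longrightarrow> f a \<noteq> 0"
  shows "weight_val w (prod f A) = (\<Sum>a\<in>A. weight_val w (f a))"
  using nz
  by (induction A rule: infinite_finite_induct)
    (simp_all add: weight_val_1[OF w] weight_val_mult[OF w])

lemma weight_val_rf_var:
  assumes "Modules.additive w"
  shows "weight_val w (rf_var i) = w (Poly_Mapping.single i 1)"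
proof -
  have "Poly_Mapping.single (Poly_Mapping.single i 1) (1::rat) \<noteq> 0"
    by (metis lookup_single_eq lookup_zero zero_neq_one)
  then show ?thesis
    using weight_val_laurent[OF assms] unfolding rf_var_eq_laurent_value
    by (metis min_weight_single zero_neq_one)
qed

section \<open>Lowest and highest powers as valuations\<close>

lemma additive_lookup: "Modules.additive (\<lambda>m :: 'n \<Rightarrow>\<^sub>0 int. Poly_Mapping.lookup m i)"
  by unfold_locales (simp add: lookup_add)

lemma additive_minus_lookup: "Modules.additive (\<lambda>m :: 'n \<Rightarrow>\<^sub>0 int. - Poly_Mapping.lookup m i)"
  by unfold_locales (simp add: lookup_add)

lemma laurent_expansion_laurent_value [simp]: "laurent_expansion (laurent_value p) = p"
  by (simp add: laurent_expansion_def)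

text \<open>For a Laurent polynomial the denominator can be taken to be 1, of weight 0; otherwise
  the default branch is the defining formula of \<open>weight_val\<close>.\<close>

lemma lowest_power_eq:
  assumes "f \<noteq> 0"
  shows "lowest_power i f = weight_val (\<lambda>m. Poly_Mapping.lookup m i) f"
proof (cases "f \<in> range laurent_value")
  case True
  with assms show ?thesis
    by (auto simp: lowest_power_def laurent_low_def min_weight_def
        weight_val_laurent[OF additive_lookup])
next
  case False
  then show ?thesis
    by (simp add: lowest_power_def weight_val_def laurent_low_def min_weight_def)
qed

lemma laurent_high_eq:
  assumes "p \<noteq> 0"
  shows "laurent_high i p = - min_weight (\<lambda>m. - Poly_Mapping.lookup m i) p"
  using minus_Max_eq_Min[of "(\<lambda>m. Poly_Mapping.lookup m i) ` Poly_Mapping.keys p"] assms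
  by (simp add: laurent_high_def min_weight_def image_image)

text \<open>Negating exponents turns maxima into minima, in numerator and denominator alike; this
  covers both branches of the definition.\<close>

lemma highest_power_eq:
  assumes "f \<noteq> 0"
  shows "highest_power i f = - weight_val (\<lambda>m. - Poly_Mapping.lookup m i) f"
proof (cases "f \<in> range laurent_value")
  case True
  with assms show ?thesis
    by (auto simp: highest_power_def laurent_high_eq weight_val_laurent[OF additive_minus_lookup])
next
  case False
  obtain p q where f: "f = laurent_value p / laurent_value q" "p \<noteq> 0" "q \<noteq> 0"
    using assms by (rule nonzero_laurent_quotient)
  let ?w = "\<lambda>m. - Poly_Mapping.lookup m i"
  have "highest_power i f = (THE d. \<exists>p q. p \<noteq> 0 \<and> q \<noteq> 0 \<and> f = laurent_value p / laurent_value q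
                         \<and> d = laurent_high i p - laurent_high i q)"
    using False by (simp add: highest_power_def)
  also have "\<dots> = - weight_val ?w f"
  proof (rule the_equality)
    show "\<exists>p q. p \<noteq> 0 \<and> q \<noteq> 0 \<and> f = laurent_value p / laurent_value q
                \<and> - weight_val ?w f = laurent_high i p - laurent_high i q"
      using f weight_val_quotient[OF additive_minus_lookup, of p q i]
      by (intro exI[of _ p] exI[of _ q]) (simp add: laurent_high_eq)
  qed (auto simp: laurent_high_eq weight_val_quotient[OF additive_minus_lookup])
  finally show ?thesis .
qed


section \<open>Subtraction-free rational functions\<close>

definition nonneg_coeffs :: "'n laurent \<Rightarrow> bool" where
  "nonneg_coeffs p \<longleftrightarrow> (\<forall>m. Poly_Mapping.lookup p m \<ge> 0)"

lemma nonneg_coeffs_single [simp]: "c \<ge> 0 \<Longrightarrow> nonneg_coeffs (Poly_Mapping.single m c)"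
  by (simp add: nonneg_coeffs_def lookup_single when_def)

lemma nonneg_coeffs_1 [simp]: "nonneg_coeffs 1"
  by (simp add: nonneg_coeffs_def lookup_one when_def)

lemma nonneg_coeffs_add [simp]:
  "nonneg_coeffs p \<Longrightarrow> nonneg_coeffs q \<Longrightarrow> nonneg_coeffs (p + q)"
  by (simp add: nonneg_coeffs_def lookup_add)

lemma nonneg_coeffs_mult [simp]:
  assumes "nonneg_coeffs p" "nonneg_coeffs q"
  shows "nonneg_coeffs (p * q)"
proof -
  have "p * q = (\<Sum>m\<in>Poly_Mapping.keys p. Poly_Mapping.single m (Poly_Mapping.lookup p m)) *
      (\<Sum>m\<in>Poly_Mapping.keys q. Poly_Mapping.single m (Poly_Mapping.lookup q m))"
    by (simp only: poly_mapping_sum_single[symmetric])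
  also have "nonneg_coeffs \<dots>"
    using assms
    by (auto simp: nonneg_coeffs_def sum_product mult_single lookup_sum lookup_single when_def
        intro!: sum_nonneg)
  finally show ?thesis .
qed

text \<open>Nonnegative coefficients sum to 0 only if both vanish, so nothing cancels. This makes
  the valuation inequality for sums an equality.\<close>

lemma keys_add_nonneg_coeffs:
  assumes "nonneg_coeffs p" "nonneg_coeffs q"
  shows "Poly_Mapping.keys (p + q) = Poly_Mapping.keys p \<union> Poly_Mapping.keys q"
  using assms by (auto simp: nonneg_coeffs_def in_keys_iff lookup_add add_nonneg_eq_0_iff)

lemma min_weight_add:
  assumes "nonneg_coeffs p" "nonneg_coeffs q" "p \<noteq> 0" "q \<noteq> 0"
  shows "min_weight w (p + q) = min (min_weight w p) (min_weight w q)"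
  using assms by (simp add: min_weight_def keys_add_nonneg_coeffs image_Un Min_Un)

lemma nonneg_coeffs_add_nonzero:
  assumes "nonneg_coeffs p" "nonneg_coeffs q" "p \<noteq> 0"
  shows "p + q \<noteq> 0"
  using keys_add_nonneg_coeffs[OF assms(1,2)] assms(3) by (metis Un_empty keys_eq_empty)

text \<open>A semifield inside the rational functions: 0 is excluded since \<open>p\<close> is
  nonzero, and sums, products and quotients stay inside.\<close>

definition subtraction_free :: "'n::{finite, linorder} ratfun \<Rightarrow> bool" where
  "subtraction_free f \<longleftrightarrow>
     (\<exists>p q. nonneg_coeffs p \<and> nonneg_coeffs q \<and> p \<noteq> 0 \<and> q \<noteq> 0 \<and>
            f = laurent_value p / laurent_value q)"

lemma subtraction_free_nonzero: "subtraction_free f \<Longrightarrow> f \<noteq> 0"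
  by (auto simp: subtraction_free_def)

lemma subtraction_free_laurent_value:
  "nonneg_coeffs p \<Longrightarrow> p \<noteq> 0 \<Longrightarrow> subtraction_free (laurent_value p)"
  unfolding subtraction_free_def by (rule exI[of _ p], rule exI[of _ 1]) simp

lemma subtraction_free_1 [simp]: "subtraction_free 1"
  using subtraction_free_laurent_value[of 1] by simp

lemma subtraction_free_rf_var [simp]: "subtraction_free (rf_var i)"
proof -
  have "Poly_Mapping.single (Poly_Mapping.single i 1) (1::rat) \<noteq> 0"
    by (metis lookup_single_eq lookup_zero zero_neq_one)
  then show ?thesis
    unfolding rf_var_eq_laurent_value
    by (rule subtraction_free_laurent_value[rotated]) simp
qed

lemma subtraction_free_mult:
  assumes "subtraction_free f" "subtraction_free g"
  shows "subtraction_free (f * g)"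
proof -
  obtain p q p' q' where
    "nonneg_coeffs p" "nonneg_coeffs q" "p \<noteq> 0" "q \<noteq> 0" "f = laurent_value p / laurent_value q"
    "nonneg_coeffs p'" "nonneg_coeffs q'" "p' \<noteq> 0" "q' \<noteq> 0" "g = laurent_value p' / laurent_value q'"
    using assms unfolding subtraction_free_def by blast
  then show ?thesis
    unfolding subtraction_free_def by (intro exI[of _ "p * p'"] exI[of _ "q * q'"]) simp
qed

lemma subtraction_free_divide:
  assumes "subtraction_free f" "subtraction_free g"
  shows "subtraction_free (f / g)"
proof -
  obtain p q p' q' where
    "nonneg_coeffs p" "nonneg_coeffs q" "p \<noteq> 0" "q \<noteq> 0" "f = laurent_value p / laurent_value q"
    "nonneg_coeffs p'" "nonneg_coeffs q'" "p' \<noteq> 0" "q' \<noteq> 0" "g = laurent_value p' / laurent_value q'"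
    using assms unfolding subtraction_free_def by blast
  then show ?thesis
    unfolding subtraction_free_def by (intro exI[of _ "p * q'"] exI[of _ "q * p'"]) simp
qed

lemma subtraction_free_prod_power:
  assumes "\<And>a. a \<in> A \<Longrightarrow> subtraction_free (f a)"
  shows "subtraction_free (\<Prod>a\<in>A. f a ^ e a)"
proof -
  have "subtraction_free (f a ^ k)" if "a \<in> A" for a k
    by (induction k) (simp_all add: subtraction_free_mult assms that)
  then show ?thesis
    by (induction A rule: infinite_finite_induct) (simp_all add: subtraction_free_mult)
qed

lemma subtraction_free_add_and_weight_val_add:
  assumes "subtraction_free f" "subtraction_free g"
  shows subtraction_free_add: "subtraction_free (f + g)"
    and weight_val_add: "Modules.additive w \<Longrightarrow>
      weight_val w (f + g) = min (weight_val w f) (weight_val w g)"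
proof -
  obtain p q where f: "nonneg_coeffs p" "nonneg_coeffs q" "p \<noteq> 0" "q \<noteq> 0"
    "f = laurent_value p / laurent_value q"
    using assms(1) unfolding subtraction_free_def by blast
  obtain p' q' where g: "nonneg_coeffs p'" "nonneg_coeffs q'" "p' \<noteq> 0" "q' \<noteq> 0"
    "g = laurent_value p' / laurent_value q'"
    using assms(2) unfolding subtraction_free_def by blast
  \<comment> \<open>Over the common denominator both summands of the numerator have nonnegative
    coefficients, so \<open>min_weight_add\<close> applies to them.\<close>
  let ?p = "p * q' + p' * q" and ?q = "q * q'"
  have p: "nonneg_coeffs ?p" "?p \<noteq> 0" "nonneg_coeffs ?q" "?q \<noteq> 0"
    using f g by (simp_all add: nonneg_coeffs_add_nonzero)
  have sum: "f + g = laurent_value ?p / laurent_value ?q"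
    using f g by (simp add: field_simps)
  show "subtraction_free (f + g)"
    unfolding subtraction_free_def using p sum by blast
  assume w: "Modules.additive w"
  have "weight_val w (f + g) = min_weight w ?p - min_weight w ?q"
    unfolding sum using w p(2,4) by (rule weight_val_quotient)
  also have "\<dots> = min (weight_val w f) (weight_val w g)"
    using f g by (simp add: min_weight_add min_weight_mult[OF w] weight_val_quotient[OF w])
  finally show "weight_val w (f + g) = min (weight_val w f) (weight_val w g)" .
qed


section \<open>Patterns on the tree\<close>

text \<open>Induction along edges from any base vertex. As \<open>linked\<close> is symmetric, each
  step is an equivalence, so \<open>Q\<close> has the same truth value everywhere as at the
  root.\<close>

lemma tree_vertex_connected:
  assumes base: "Q t0" and step: "\<And>k t t'. linked k t t' \<Longrightarrow> Q t \<Longrightarrow> Q t'"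
  shows "Q t"
proof -
  have root: "Q (vertex_of w) \<longleftrightarrow> Q (vertex_of [])" if "distinct_adj w" for w
    using that
  proof (induction w)
    case (Cons k w)
    then have "distinct_adj w"
      by (cases w) simp_all
    with Cons.prems have "linked k (vertex_of w) (vertex_of (k # w))"
      by (simp add: linked_def vertex_of_inverse)
    then have "Q (vertex_of (k # w)) \<longleftrightarrow> Q (vertex_of w)"
      using step linked_sym by metis
    with Cons.IH \<open>distinct_adj w\<close> show ?case by simp
  qed simp
  have "Q t \<longleftrightarrow> Q (vertex_of [])" for t
    using root[of "word_of t"] word_of[of t] by (simp add: word_of_inverse)
  with base show ?thesis by blast
qed

text \<open>At the root an orbit is read off from the words; the base vertex is then moved along an edge
  by mutating the seed.\<close>

lemma mutation_orbit_exists: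
  assumes closed: "\<And>k s. s \<in> G \<Longrightarrow> \<mu> k s \<in> G"
    and invol: "\<And>k s. s \<in> G \<Longrightarrow> \<mu> k (\<mu> k s) = s"
    and "s \<in> G"
  shows "\<exists>\<sigma>. \<sigma> t0 = s \<and> (\<forall>t. \<sigma> t \<in> G) \<and> (\<forall>k t t'. linked k t t' \<longrightarrow> \<sigma> t' = \<mu> k (\<sigma> t))"
proof -
  let ?orbit = "\<lambda>\<sigma>. (\<forall>t. \<sigma> t \<in> G) \<and> (\<forall>k t t'. linked k t t' \<longrightarrow> \<sigma> t' = \<mu> k (\<sigma> t))"
  have "\<forall>s\<in>G. \<exists>\<sigma>. \<sigma> t0 = s \<and> ?orbit \<sigma>"
  proof (rule tree_vertex_connected[of _ "vertex_of []"])
    show "\<forall>s\<in>G. \<exists>\<sigma>. \<sigma> (vertex_of []) = s \<and> ?orbit \<sigma>"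
    proof
      fix s assume "s \<in> G"
      \<comment> \<open>The head of a word labels the edge to its parent, so its mutation has to be
        applied last, as \<open>foldr\<close> does.\<close>
      define \<sigma> where "\<sigma> t = foldr \<mu> (word_of t) s" for t
      have "foldr \<mu> w s \<in> G" for w
        by (induction w) (simp_all add: \<open>s \<in> G\<close> closed)
      then have G: "\<sigma> t \<in> G" for t
        by (simp add: \<sigma>_def)
      have "\<sigma> t' = \<mu> k (\<sigma> t)" if "linked k t t'" for k t t'
        using that unfolding linked_def
      proof
        assume "word_of t' = k # word_of t"
        then show ?thesis by (simp add: \<sigma>_def)
      next
        assume "word_of t = k # word_of t'"
        then have "\<sigma> t = \<mu> k (\<sigma> t')" by (simp add: \<sigma>_def)
        then show ?thesis using invol[OF G] by simp
      qed
      then show "\<exists>\<sigma>. \<sigma> (vertex_of []) = s \<and> ?orbit \<sigma>"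
        using G by (intro exI[of _ \<sigma>]) (simp add: \<sigma>_def vertex_of_inverse)
    qed
  next
    fix k t t'
    assume link: "linked k t t'" and IH: "\<forall>s\<in>G. \<exists>\<sigma>. \<sigma> t = s \<and> ?orbit \<sigma>"
    show "\<forall>s\<in>G. \<exists>\<sigma>. \<sigma> t' = s \<and> ?orbit \<sigma>"
    proof
      fix s assume "s \<in> G"
      \<comment> \<open>Prescribing the mutated seed at \<open>t\<close> makes the orbit return to
        \<open>s\<close> when it crosses the edge to \<open>t'\<close>.\<close>
      then obtain \<sigma> where "\<sigma> t = \<mu> k s" "?orbit \<sigma>"
        using IH closed by blast
      moreover from this have "\<sigma> t' = s"
        using link invol[OF \<open>s \<in> G\<close>] by metis
      ultimately show "\<exists>\<sigma>. \<sigma> t' = s \<and> ?orbit \<sigma>" by blast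
    qed
  qed
  with \<open>s \<in> G\<close> show ?thesis by blast
qed

section \<open>Mutation of skew-symmetrizable matrices\<close>

lemma matrix_mutation_involutive [simp]: "matrix_mutation k (matrix_mutation k B) = B"
  by (simp add: matrix_mutation_def vec_eq_iff)

text \<open>The correction term vanishes unless b_ik and b_kj have the same sign, so either sign may
  stand in front of it, and transposition exchanges the two. Hence the matrices
  \<open>transpose (- B)\<close> mutate along with \<open>B\<close>.\<close>

lemma matrix_mutation_neg_transpose:
  "matrix_mutation k (transpose (- B)) = transpose (- matrix_mutation k B)"
proof -
  have "sgn (- a) * max (a * b) 0 = - (sgn b * max (b * a) 0)" for a b :: int
    by (auto simp: sgn_if max_def mult.commute zero_less_mult_iff not_le mult_le_0_iff)
  then show ?thesis
    by (simp add: matrix_mutation_def vec_eq_iff transpose_def)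
qed

lemma skew_symmetrizable_diagonal: "skew_symmetrizable B \<Longrightarrow> B $ i $ i = 0"
  unfolding skew_symmetrizable_def by (metis equal_neg_zero less_irrefl mult_eq_0_iff)

lemma skew_symmetrizable_neg_transpose:
  assumes "skew_symmetrizable B"
  shows "skew_symmetrizable (transpose (- B))"
proof -
  obtain d where pos: "d i > 0" and skew: "d i * B $ i $ j = - (d j * B $ j $ i)" for i j
    using assms unfolding skew_symmetrizable_def by blast
  \<comment> \<open>The reciprocals of the \<open>d i\<close> symmetrize the transpose; the product
    of all \<open>d l\<close> clears their denominators.\<close>
  define e where "e i = (\<Prod>l\<in>UNIV - {i}. d l)" for i
  have e: "e i * d i = prod d UNIV" for i
    by (simp add: e_def mult.commute flip: prod.remove)
  have "e i > 0" for i
    by (simp add: e_def pos prod_pos)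
  moreover have "e i * transpose (- B) $ i $ j = - (e j * transpose (- B) $ j $ i)" for i j
  proof -
    have "d i * d j * (e i * B $ j $ i) = prod d UNIV * (d j * B $ j $ i)"
      by (simp add: algebra_simps flip: e[of i])
    also have "\<dots> = - (prod d UNIV * (d i * B $ i $ j))"
      using skew[of j i] by simp
    also have "\<dots> = d i * d j * - (e j * B $ i $ j)"
      by (simp add: algebra_simps flip: e[of j])
    finally have "d i * d j * (e i * B $ j $ i) = d i * d j * - (e j * B $ i $ j)" .
    moreover have "d i * d j \<noteq> 0"
      using pos[of i] pos[of j] by simp
    ultimately have "e i * B $ j $ i = - (e j * B $ i $ j)"
      using mult_left_cancel[of "d i * d j"] by blast
    then show ?thesis by (simp add: transpose_def)
  qed
  ultimately show ?thesis
    unfolding skew_symmetrizable_def by blast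
qed

text \<open>The same \<open>d\<close> serves: passing twice through index k turns d_i b_ik b_kj into
  d_j b_jk b_ki, so the correction terms are skew as well.\<close>

lemma skew_symmetrizable_mutation:
  assumes "skew_symmetrizable B"
  shows "skew_symmetrizable (matrix_mutation k B)"
proof -
  obtain d where pos: "\<And>i. d i > 0" and skew: "\<And>i j. d i * B $ i $ j = - (d j * B $ j $ i)"
    using assms unfolding skew_symmetrizable_def by blast
  have sgn_skew: "sgn (B $ i $ j) = - sgn (B $ j $ i)" for i j
    using arg_cong[OF skew[of i j], of sgn] pos[of i] pos[of j] by (simp add: sgn_mult)
  have incr: "d i * (sgn (B $ i $ k) * max (B $ i $ k * B $ k $ j) 0) =
      - (d j * (sgn (B $ j $ k) * max (B $ j $ k * B $ k $ i) 0))" for i j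
  proof -
    have scale: "d l * max (a * b) 0 = max (d l * a * b) 0" for l a b
      using pos[of l] by (simp add: max_mult_distrib_left mult.assoc)
    have prod: "d i * B $ i $ k * B $ k $ j = d j * B $ j $ k * B $ k $ i"
    proof -
      have "d i * B $ i $ k * B $ k $ j = - (B $ k $ i * (d k * B $ k $ j))"
        using skew[of i k] by simp
      also have "\<dots> = d j * B $ j $ k * B $ k $ i"
        using skew[of k j] by simp
      finally show ?thesis .
    qed
    have sgn: "sgn (B $ i $ k) * max (B $ i $ k * B $ k $ j) 0 =
        - sgn (B $ j $ k) * max (B $ i $ k * B $ k $ j) 0"
    proof (cases "B $ i $ k * B $ k $ j > 0")
      case True
      \<comment> \<open>Where the positive part is nonzero, b_ik and b_kj share a sign, and b_jk has
        the opposite one.\<close>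
      then have "sgn (B $ i $ k) = sgn (B $ k $ j)"
        by (auto simp: zero_less_mult_iff)
      then show ?thesis using sgn_skew[of k j] by simp
    qed (simp add: max_def)
    have "d i * (sgn (B $ i $ k) * max (B $ i $ k * B $ k $ j) 0) =
        - (sgn (B $ j $ k) * (d i * max (B $ i $ k * B $ k $ j) 0))"
      by (simp add: sgn)
    also have "\<dots> = - (sgn (B $ j $ k) * (d j * max (B $ j $ k * B $ k $ i) 0))"
      by (simp only: scale prod)
    finally show ?thesis by (simp add: mult.left_commute)
  qed
  have "d i * matrix_mutation k B $ i $ j = - (d j * matrix_mutation k B $ j $ i)" for i j
  proof (cases "i = k \<or> j = k")
    case True
    then show ?thesis by (simp add: matrix_mutation_def disj_commute skew[of i j])
  next
    case False
    then show ?thesis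
      unfolding matrix_mutation_def using skew[of i j] incr[of i j] by (simp add: distrib_left)
  qed
  with pos show ?thesis
    unfolding skew_symmetrizable_def by blast
qed

section \<open>Seeds and their mutation\<close>

definition exchange_binomial ::
  "'n int_matrix \<Rightarrow> ('n::{finite, linorder} \<Rightarrow> 'n ratfun) \<Rightarrow> 'n \<Rightarrow> 'n ratfun" where
  "exchange_binomial B x k =
     (\<Prod>l\<in>UNIV. x l ^ nat (max (B $ l $ k) 0)) + (\<Prod>l\<in>UNIV. x l ^ nat (max (- B $ l $ k) 0))"

lemma subtraction_free_exchange_binomial:
  "(\<And>l. subtraction_free (x l)) \<Longrightarrow> subtraction_free (exchange_binomial B x k)"
  by (simp add: exchange_binomial_def subtraction_free_add subtraction_free_prod_power)

text \<open>The zero diagonal entry removes \<open>x k\<close> from both monomials, so the binomial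
  survives the replacement of that variable.\<close>

lemma exchange_binomial_cong:
  assumes "\<And>l. l \<noteq> k \<Longrightarrow> x l = y l" "B $ k $ k = 0"
  shows "exchange_binomial B x k = exchange_binomial B y k"
proof -
  have "x l ^ nat (max (B $ l $ k) 0) = y l ^ nat (max (B $ l $ k) 0)"
    "x l ^ nat (max (- B $ l $ k) 0) = y l ^ nat (max (- B $ l $ k) 0)" for l
    using assms by (cases "l = k"; simp)+
  then show ?thesis by (simp add: exchange_binomial_def)
qed

lemma exchange_binomial_mutation:
  "exchange_binomial (matrix_mutation k B) x k = exchange_binomial B x k"
  by (simp add: exchange_binomial_def matrix_mutation_def add.commute)

definition seed_mutation ::
  "'n \<Rightarrow> 'n int_matrix \<times> ('n::{finite, linorder} \<Rightarrow> 'n ratfun) \<Rightarrow> 'n int_matrix \<times> ('n \<Rightarrow> 'n ratfun)"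
  where "seed_mutation k s =
    (matrix_mutation k (fst s), (snd s)(k := exchange_binomial (fst s) (snd s) k / snd s k))"

text \<open>The invariant that keeps variables and binomials nonzero, so that the division in
  \<open>seed_mutation\<close> can be undone.\<close>

definition subtraction_free_seeds :: "('n int_matrix \<times> ('n::{finite, linorder} \<Rightarrow> 'n ratfun)) set" where
  "subtraction_free_seeds = {(B, x). skew_symmetrizable B \<and> (\<forall>i. subtraction_free (x i))}"

lemma seed_mutation_closed:
  "s \<in> subtraction_free_seeds \<Longrightarrow> seed_mutation k s \<in> subtraction_free_seeds"
  by (auto simp: subtraction_free_seeds_def seed_mutation_def skew_symmetrizable_mutation
      subtraction_free_divide subtraction_free_exchange_binomial)

lemma seed_mutation_involutive:
  assumes "s \<in> subtraction_free_seeds"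
  shows "seed_mutation k (seed_mutation k s) = s"
proof (cases s)
  case (Pair B x)
  with assms have skew: "skew_symmetrizable B" and x: "subtraction_free (x i)" for i
    by (auto simp: subtraction_free_seeds_def)
  let ?P = "exchange_binomial B x k"
  have "exchange_binomial B (x(k := ?P / x k)) k = ?P"
    using skew_symmetrizable_diagonal[OF skew] by (intro exchange_binomial_cong) auto
  moreover have "?P \<noteq> 0" "x k \<noteq> 0"
    using x by (simp_all add: subtraction_free_nonzero subtraction_free_exchange_binomial)
  ultimately show ?thesis
    by (simp add: Pair seed_mutation_def exchange_binomial_mutation)
qed

section \<open>Existence and uniqueness of the cluster pattern\<close>

lemma is_cluster_pattern_iff:
  "is_cluster_pattern B0 t0 B x \<longleftrightarrow>
     B t0 = B0 \<and> x t0 = rf_var \<and>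
     (\<forall>k t t'. linked k t t' \<longrightarrow>
        B t' = matrix_mutation k (B t) \<and> (\<forall>j. j \<noteq> k \<longrightarrow> x t' j = x t j) \<and>
        x t' k * x t k = exchange_binomial (B t) (x t) k)"
  by (auto simp: is_cluster_pattern_def exchange_binomial_def fun_eq_iff)

text \<open>The orbit of the initial seed is a pattern. It is the only one because
  \<open>x t k\<close> is nonzero, so the exchange relation can be solved for the new variable along
  each edge.\<close>

lemma cluster_pattern_unique_subtraction_free:
  assumes "skew_symmetrizable B0"
  shows "\<exists>\<sigma>. (\<forall>t. \<sigma> t \<in> subtraction_free_seeds) \<and>
           (\<forall>B x. is_cluster_pattern B0 t0 B x \<longleftrightarrow> (\<forall>t. (B t, x t) = \<sigma> t))"
proof -
  have "(B0, rf_var) \<in> subtraction_free_seeds"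
    using assms by (simp add: subtraction_free_seeds_def)
  then obtain \<sigma> where init: "\<sigma> t0 = (B0, rf_var)"
    and good: "\<And>t. \<sigma> t \<in> subtraction_free_seeds"
    and step: "\<And>k t t'. linked k t t' \<Longrightarrow> \<sigma> t' = seed_mutation k (\<sigma> t)"
    using mutation_orbit_exists[where \<mu> = seed_mutation,
        OF seed_mutation_closed seed_mutation_involutive, of "(B0, rf_var)" t0] by blast
  have nz: "snd (\<sigma> t) j \<noteq> 0" for t j
    using good[of t] by (auto simp: subtraction_free_seeds_def subtraction_free_nonzero split: prod.splits)
  have pattern: "is_cluster_pattern B0 t0 (\<lambda>t. fst (\<sigma> t)) (\<lambda>t. snd (\<sigma> t))"
    unfolding is_cluster_pattern_iff using init step nz by (simp add: seed_mutation_def)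
  have "(B t, x t) = \<sigma> t" if P: "is_cluster_pattern B0 t0 B x" for B x t
  proof (rule tree_vertex_connected[of _ t0])
    show "(B t0, x t0) = \<sigma> t0"
      using P init by (simp add: is_cluster_pattern_iff)
  next
    fix k t t' assume link: "linked k t t'" and eq: "(B t, x t) = \<sigma> t"
    from P link have B: "B t' = matrix_mutation k (B t)"
      and x: "\<And>j. j \<noteq> k \<Longrightarrow> x t' j = x t j" "x t' k * x t k = exchange_binomial (B t) (x t) k"
      by (auto simp: is_cluster_pattern_iff)
    have "x t k \<noteq> 0"
      using nz[of t k] by (simp flip: eq)
    with x have "x t' = (x t)(k := exchange_binomial (B t) (x t) k / x t k)"
      by (auto simp: fun_eq_iff field_simps)
    with B show "(B t', x t') = \<sigma> t'"
      by (simp add: step[OF link] seed_mutation_def flip: eq)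
  qed
  moreover have "is_cluster_pattern B0 t0 B x" if "\<And>t. (B t, x t) = \<sigma> t" for B x
    using pattern by (simp flip: that)
  ultimately show ?thesis
    using good by blast
qed

text \<open>By uniqueness the definite description in \<open>cluster_pattern\<close> denotes the
  orbit and inherits its invariants.\<close>

lemma cluster_pattern_properties:
  assumes "skew_symmetrizable B0"
  shows is_cluster_pattern_cluster_pattern:
      "is_cluster_pattern B0 t0 (exchange_matrix B0 t0) (cluster_variable B0 t0)"
    and skew_symmetrizable_exchange_matrix: "skew_symmetrizable (exchange_matrix B0 t0 t)"
    and subtraction_free_cluster_variable: "subtraction_free (cluster_variable B0 t0 t j)"
proof -
  obtain \<sigma> where good: "\<And>t. \<sigma> t \<in> subtraction_free_seeds"
    and unique: "\<And>B x. is_cluster_pattern B0 t0 B x \<longleftrightarrow> (\<forall>t. (B t, x t) = \<sigma> t)"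
    using cluster_pattern_unique_subtraction_free[OF assms, of t0] by metis
  have "cluster_pattern B0 t0 = (fst \<circ> \<sigma>, snd \<circ> \<sigma>)"
    unfolding cluster_pattern_def
  proof (rule the_equality)
    fix P assume "is_cluster_pattern B0 t0 (fst P) (snd P)"
    then have "(fst P t, snd P t) = \<sigma> t" for t
      using unique by blast
    then show "P = (fst \<circ> \<sigma>, snd \<circ> \<sigma>)"
      by (metis comp_apply ext fst_conv prod.collapse snd_conv)
  qed (simp add: unique)
  then have eqs: "exchange_matrix B0 t0 t = fst (\<sigma> t)" "cluster_variable B0 t0 t = snd (\<sigma> t)" for t
    by (simp_all add: exchange_matrix_def cluster_variable_def fun_eq_iff)
  show "is_cluster_pattern B0 t0 (exchange_matrix B0 t0) (cluster_variable B0 t0)"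
    by (simp add: unique eqs)
  show "skew_symmetrizable (exchange_matrix B0 t0 t)"
    "subtraction_free (cluster_variable B0 t0 t j)"
    using good[of t] by (auto simp: eqs subtraction_free_seeds_def split: prod.splits)
qed

text \<open>This lets the initial vertex move freely within one family of matrices.\<close>

lemma exchange_matrix_unique:
  assumes "skew_symmetrizable (B t0)"
    and mut: "\<And>k t t'. linked k t t' \<Longrightarrow> B t' = matrix_mutation k (B t)"
  shows "exchange_matrix (B t0) t0 t = B t"
proof -
  have P: "is_cluster_pattern (B t0) t0 (exchange_matrix (B t0) t0) (cluster_variable (B t0) t0)"
    using assms(1) by (rule is_cluster_pattern_cluster_pattern)
  show ?thesis
  proof (rule tree_vertex_connected[of _ t0])
    show "exchange_matrix (B t0) t0 t0 = B t0"
      using P by (simp add: is_cluster_pattern_iff)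
  next
    fix k t t' assume "linked k t t'" "exchange_matrix (B t0) t0 t = B t"
    then show "exchange_matrix (B t0) t0 t' = B t'"
      using P mut by (simp add: is_cluster_pattern_iff)
  qed
qed


section \<open>Tropical cluster patterns\<close>

text \<open>The tropicalization of \<open>exchange_binomial\<close>: products become sums, and the
  sum becomes a minimum.\<close>

definition tropical_binomial :: "'n::finite int_matrix \<Rightarrow> ('n \<Rightarrow> int) \<Rightarrow> 'n \<Rightarrow> int" where
  "tropical_binomial B u k =
     min (\<Sum>l\<in>UNIV. max (B $ l $ k) 0 * u l) (\<Sum>l\<in>UNIV. max (- B $ l $ k) 0 * u l)"

definition tropical_pattern ::
  "('n::finite tree_vertex \<Rightarrow> 'n int_matrix) \<Rightarrow> ('n tree_vertex \<Rightarrow> 'n \<Rightarrow> int) \<Rightarrow> bool" where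
  "tropical_pattern B u \<longleftrightarrow>
     (\<forall>k t t'. linked k t t' \<longrightarrow>
        u t' k = - u t k + tropical_binomial (B t) (u t) k \<and> (\<forall>j. j \<noteq> k \<longrightarrow> u t' j = u t j))"

lemma tropical_pattern_unique:
  assumes "tropical_pattern B u" "tropical_pattern B v" "u s = v s"
  shows "u t = v t"
proof (rule tree_vertex_connected[of _ s])
  fix k t t' assume "linked k t t'" "u t = v t"
  then have "u t' j = v t' j" for j
    using assms(1,2) by (cases "j = k") (simp_all add: tropical_pattern_def)
  then show "u t' = v t'" ..
qed fact

lemma weight_val_exchange_binomial:
  assumes w: "Modules.additive w" and x: "\<And>l. subtraction_free (x l)"
  shows "weight_val w (exchange_binomial B x k) = tropical_binomial B (\<lambda>l. weight_val w (x l)) k"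
  unfolding exchange_binomial_def tropical_binomial_def
  by (simp add: weight_val_add[OF _ _ w] weight_val_prod[OF w] weight_val_power[OF w] x
      subtraction_free_prod_power subtraction_free_nonzero)

lemma tropical_pattern_weight_val:
  assumes w: "Modules.additive w" and skew: "skew_symmetrizable B0"
  shows "tropical_pattern (exchange_matrix B0 t0) (\<lambda>t j. weight_val w (cluster_variable B0 t0 t j))"
  unfolding tropical_pattern_def
proof (intro allI impI)
  fix k t t' assume link: "linked k (t :: 'a tree_vertex) t'"
  let ?x = "cluster_variable B0 t0"
  have P: "(\<forall>j. j \<noteq> k \<longrightarrow> ?x t' j = ?x t j) \<and>
      ?x t' k * ?x t k = exchange_binomial (exchange_matrix B0 t0 t) (?x t) k"
    using is_cluster_pattern_cluster_pattern[OF skew, of t0] link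
    by (simp add: is_cluster_pattern_iff)
  have sf: "subtraction_free (?x t j)" for t j
    using skew by (rule subtraction_free_cluster_variable)
  have "weight_val w (?x t' k) + weight_val w (?x t k) = weight_val w (?x t' k * ?x t k)"
    using w by (simp add: weight_val_mult subtraction_free_nonzero[OF sf])
  also have "\<dots> =
      tropical_binomial (exchange_matrix B0 t0 t) (\<lambda>j. weight_val w (?x t j)) k"
    using P by (simp add: weight_val_exchange_binomial[OF w sf])
  finally show "weight_val w (?x t' k) = - weight_val w (?x t k) +
      tropical_binomial (exchange_matrix B0 t0 t) (\<lambda>j. weight_val w (?x t j)) k \<and>
      (\<forall>j. j \<noteq> k \<longrightarrow> weight_val w (?x t' j) = weight_val w (?x t j))"
    using P by simp
qed

lemma weight_val_initial_cluster:
  assumes "Modules.additive w" "skew_symmetrizable B0"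
  shows "weight_val w (cluster_variable B0 t0 t0 j) = w (Poly_Mapping.single j 1)"
  using is_cluster_pattern_cluster_pattern[OF assms(2), of t0]
  by (simp add: is_cluster_pattern_iff weight_val_rf_var[OF assms(1)])

lemma D_matrix_eq_weight_val:
  assumes "skew_symmetrizable B0"
  shows "D_matrix B0 t0 t $ i $ j =
    - weight_val (\<lambda>m. Poly_Mapping.lookup m i) (cluster_variable B0 t0 t j)"
  using subtraction_free_nonzero[OF subtraction_free_cluster_variable[OF assms]]
  by (simp add: D_matrix_def lowest_power_eq)

lemma M_matrix_eq_weight_val:
  assumes "skew_symmetrizable B0"
  shows "M_matrix B0 t0 t $ i $ j =
    - weight_val (\<lambda>m. - Poly_Mapping.lookup m i) (cluster_variable B0 t0 t j)"
  using subtraction_free_nonzero[OF subtraction_free_cluster_variable[OF assms]]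
  by (simp add: M_matrix_def highest_power_eq)


section \<open>Equivalence of the three properties\<close>

text \<open>Free of a base vertex: any vertex may serve as the initial one, and the family of
  matrices \<open>transpose (- B t)\<close> is another instance.\<close>

locale matrix_pattern =
  fixes B :: "'n::{finite, linorder} tree_vertex \<Rightarrow> 'n int_matrix"
  assumes skew: "skew_symmetrizable (B t)"
    and mutation: "linked k t t' \<Longrightarrow> B t' = matrix_mutation k (B t)"
begin

lemma exchange_matrix_eq: "exchange_matrix (B t0) t0 = B"
  by (rule ext, rule exchange_matrix_unique[of B]) (rule skew, rule mutation)

lemma neg_transpose: "matrix_pattern (\<lambda>t. transpose (- B t))"
  by unfold_locales
    (simp_all add: skew skew_symmetrizable_neg_transpose mutation matrix_mutation_neg_transpose)

lemma tropical_pattern_cluster_variables: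
  "Modules.additive w \<Longrightarrow>
    tropical_pattern B (\<lambda>t j. weight_val w (cluster_variable (B t0) t0 t j))"
  using tropical_pattern_weight_val[OF _ skew, of w t0 t0] by (simp add: exchange_matrix_eq)

text \<open>Both sides form tropical patterns in the final vertex, so it suffices to compare them at the
  vertex adjacent to the initial one.\<close>

lemma weight_val_initial_mutation:
  assumes w: "Modules.additive w" and w': "Modules.additive w'" and link: "linked k t0 t1"
    and other: "\<And>j. j \<noteq> k \<Longrightarrow> w (Poly_Mapping.single j 1) = w' (Poly_Mapping.single j 1)"
    and k: "w (Poly_Mapping.single k 1) = - w' (Poly_Mapping.single k 1) +
      tropical_binomial (B t0) (\<lambda>l. w' (Poly_Mapping.single l 1)) k"
  shows "weight_val w (cluster_variable (B t1) t1 t j) =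
         weight_val w' (cluster_variable (B t0) t0 t j)"
proof -
  let ?u = "\<lambda>t j. weight_val w (cluster_variable (B t1) t1 t j)"
  let ?v = "\<lambda>t j. weight_val w' (cluster_variable (B t0) t0 t j)"
  have v: "tropical_pattern B ?v"
    using w' by (rule tropical_pattern_cluster_variables)
  have "?u t1 j = ?v t1 j" for j
    using v link other k
    by (cases "j = k")
      (simp_all add: tropical_pattern_def weight_val_initial_cluster[OF w skew]
        weight_val_initial_cluster[OF w' skew])
  then have "?u t1 = ?v t1" ..
  then have "?u t = ?v t"
    by (rule tropical_pattern_unique[OF tropical_pattern_cluster_variables[OF w] v])
  then show ?thesis by (rule fun_cong)
qed

text \<open>The lowest power of the i-th variable is the same valuation for both initial clusters:
  it is 0 on the old k-th variable, and on the new one it is the smaller of the positive and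
  negative parts of b_ik, again 0.\<close>

lemma D_matrix_initial_mutation_other_row:
  assumes "linked k t0 t1" "i \<noteq> k"
  shows "D_matrix (B t1) t1 t $ i $ j = D_matrix (B t0) t0 t $ i $ j"
proof -
  have "(\<Sum>l\<in>UNIV. a l * Poly_Mapping.lookup (Poly_Mapping.single l 1) i) = a i"
    for a :: "'n \<Rightarrow> int"
    by (simp add: lookup_single when_def if_distrib cong: if_cong)
  then have "tropical_binomial (B t0) (\<lambda>l. Poly_Mapping.lookup (Poly_Mapping.single l 1) i) k = 0"
    unfolding tropical_binomial_def by (simp add: min_def max_def)
  with assms show ?thesis
    unfolding D_matrix_eq_weight_val[OF skew]
    by (subst weight_val_initial_mutation[OF additive_lookup additive_lookup])
      (auto simp: lookup_single)
qed

text \<open>As b_kk is 0, the old and new k-th variables have a product free of both. Lowest powers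
  of the new one are therefore minus the highest powers of the old one.\<close>

lemma D_matrix_initial_mutation_row:
  assumes "linked k t0 t1"
  shows "D_matrix (B t1) t1 t $ k $ j = M_matrix (B t0) t0 t $ k $ j"
proof -
  have "(\<Sum>l\<in>UNIV. a l * - (1 when l = k)) = - a k" for a :: "'n \<Rightarrow> int"
    by (simp add: when_def if_distrib sum_negf cong: if_cong)
  then have "tropical_binomial (B t0) (\<lambda>l. - Poly_Mapping.lookup (Poly_Mapping.single l 1) k) k = 0"
    by (simp only: tropical_binomial_def lookup_single skew_symmetrizable_diagonal[OF skew])
  with assms show ?thesis
    unfolding D_matrix_eq_weight_val[OF skew] M_matrix_eq_weight_val[OF skew]
    by (subst weight_val_initial_mutation[OF additive_lookup additive_minus_lookup])
      (auto simp: lookup_single)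
qed

text \<open>The (k, j) entry shared by the right-hand sides of R and M; both involve only row k of
  \<open>B t0\<close>.\<close>

definition row_recursion :: "'n tree_vertex \<Rightarrow> 'n tree_vertex \<Rightarrow> 'n \<Rightarrow> 'n \<Rightarrow> int" where
  "row_recursion t0 t k j = - D_matrix (B t0) t0 t $ k $ j +
     max (\<Sum>l\<in>UNIV. max (B t0 $ k $ l) 0 * D_matrix (B t0) t0 t $ l $ j)
         (\<Sum>l\<in>UNIV. max (- B t0 $ k $ l) 0 * D_matrix (B t0) t0 t $ l $ j)"

text \<open>Outside row k the equation holds anyway: its right-hand side keeps the old row, and so
  does the change of initial vertex.\<close>

lemma property_R_iff:
  "property_R B \<longleftrightarrow> (\<forall>t0 t k t1 j. linked k t0 t1 \<longrightarrow>
      D_matrix (B t1) t1 t $ k $ j = row_recursion t0 t k j)"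
proof -
  have "D_matrix (B t1) t1 t =
      J_matrix k ** D_matrix (B t0) t0 t +
      mat_max (mat_pos (row_part k (B t0)) ** D_matrix (B t0) t0 t)
              (mat_pos (- row_part k (B t0)) ** D_matrix (B t0) t0 t) \<longleftrightarrow>
      (\<forall>j. D_matrix (B t1) t1 t $ k $ j = row_recursion t0 t k j)" (is "?D1 = ?R \<longleftrightarrow> _")
    if "linked k t0 t1" for k t0 t1 t
  proof -
    have J: "(J_matrix k ** D_matrix (B t0) t0 t) $ i $ j =
        (if i = k then - D_matrix (B t0) t0 t $ i $ j else D_matrix (B t0) t0 t $ i $ j)" for i j
      by (simp add: J_matrix_def matrix_matrix_mult_def if_distrib[of "\<lambda>a. a * _"] cong: if_cong)
    have "?R $ k $ j = row_recursion t0 t k j" for j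
      unfolding vector_add_component J
      by (simp add: mat_max_def mat_pos_def row_part_def matrix_matrix_mult_def row_recursion_def)
    moreover have "?R $ i $ j = ?D1 $ i $ j" if "i \<noteq> k" for i j
      unfolding vector_add_component J
        D_matrix_initial_mutation_other_row[OF \<open>linked k t0 t1\<close> that]
      using that by (simp add: mat_max_def mat_pos_def row_part_def matrix_matrix_mult_def)
    ultimately show ?thesis
      unfolding vec_eq_iff by metis
  qed
  then show ?thesis
    unfolding property_R_def by metis
qed

lemma property_M_iff:
  "property_M B \<longleftrightarrow> (\<forall>t0 t k j. M_matrix (B t0) t0 t $ k $ j = row_recursion t0 t k j)"
  by (simp add: property_M_def vec_eq_iff row_recursion_def mat_max_def mat_pos_def
      matrix_matrix_mult_def)

text \<open>Row k of the D-matrix at the k-neighbour of \<open>t0\<close> is row k of the M-matrix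
  at \<open>t0\<close>, and \<open>linked_ex1\<close> supplies this neighbour for every k.\<close>

lemma property_R_iff_property_M: "property_R B \<longleftrightarrow> property_M B"
  unfolding property_R_iff property_M_iff
  using D_matrix_initial_mutation_row linked_ex1 by metis

text \<open>The final vertex and the column stay fixed while the initial vertex moves. Negation
  turns the maximum into a minimum, and transposition turns row k into the column read by
  \<open>tropical_binomial\<close>.\<close>

lemma property_R_iff_tropical_pattern:
  "property_R B \<longleftrightarrow>
    (\<forall>t j. tropical_pattern (\<lambda>s. transpose (- B s)) (\<lambda>s i. - D_matrix (B s) s t $ i $ j))"
proof -
  have "row_recursion t0 t k j = - D_matrix (B t0) t0 t $ k $ j -
      tropical_binomial (transpose (- B t0)) (\<lambda>i. - D_matrix (B t0) t0 t $ i $ j) k" for t0 t k j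
    by (simp add: row_recursion_def tropical_binomial_def transpose_def sum_negf max.commute
        flip: minus_max_eq_min)
  then have "tropical_pattern (\<lambda>s. transpose (- B s)) (\<lambda>s i. - D_matrix (B s) s t $ i $ j) \<longleftrightarrow>
      (\<forall>k t0 t1. linked k t0 t1 \<longrightarrow> D_matrix (B t1) t1 t $ k $ j = row_recursion t0 t k j)" for t j
    unfolding tropical_pattern_def
    by (intro iff_allI imp_cong refl) (auto simp: D_matrix_initial_mutation_other_row)
  then show ?thesis
    unfolding property_R_iff by blast
qed

lemma property_D_iff_property_R: "property_D B \<longleftrightarrow> property_R B"
proof -
  interpret dual: matrix_pattern "\<lambda>t. transpose (- B t)"
    by (rule neg_transpose)
  \<comment> \<open>\<open>u\<close> follows column \<open>j\<close> as the initial vertex moves,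
    \<open>v\<close> follows row \<open>j\<close> of the dual matrices as their final vertex moves;
    property D says that they coincide.\<close>
  define u where "u j t = (\<lambda>s i. - D_matrix (B s) s t $ i $ j)" for j t
  define v where "v j t = (\<lambda>s i. - D_matrix (transpose (- B t)) t s $ j $ i)" for j t
  have v: "tropical_pattern (\<lambda>s. transpose (- B s)) (v j t)" for j t
    using dual.tropical_pattern_cluster_variables[OF additive_lookup, of j t]
    by (simp add: v_def D_matrix_eq_weight_val[OF dual.skew])
  \<comment> \<open>At the initial vertex both D-matrices are minus the identity, which is
    symmetric, so the two families agree there.\<close>
  have diag: "u j t t = v j t t" for j t
    by (simp add: fun_eq_iff u_def v_def D_matrix_eq_weight_val skew dual.skew
        weight_val_initial_cluster[OF additive_lookup] lookup_single when_def)
  have "property_D B \<longleftrightarrow> (\<forall>j t s. u j t s = v j t s)"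
    by (auto simp: property_D_def u_def v_def vec_eq_iff transpose_def fun_eq_iff)
  also have "\<dots> \<longleftrightarrow> (\<forall>t j. tropical_pattern (\<lambda>s. transpose (- B s)) (u j t))"
  proof
    assume "\<forall>j t s. u j t s = v j t s"
    then have "u j t = v j t" for j t by (simp add: fun_eq_iff)
    with v show "\<forall>t j. tropical_pattern (\<lambda>s. transpose (- B s)) (u j t)" by simp
  next
    assume u: "\<forall>t j. tropical_pattern (\<lambda>s. transpose (- B s)) (u j t)"
    have "u j t s = v j t s" for j t s
      by (rule tropical_pattern_unique[OF _ v diag]) (use u in blast)
    then show "\<forall>j t s. u j t s = v j t s" by blast
  qed
  also have "\<dots> \<longleftrightarrow> property_R B"
    by (simp add: property_R_iff_tropical_pattern u_def)
  finally show ?thesis .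
qed

end

theorem theorem1p1:
  fixes B0 :: "'n::{finite, linorder} int_matrix"
    and r :: "'n tree_vertex"
    and B :: "'n tree_vertex \<Rightarrow> 'n int_matrix"
  assumes "skew_symmetrizable B0"
    and "\<And>s. B s = exchange_matrix B0 r s"
  shows "(property_D B \<longleftrightarrow> property_R B) \<and> (property_R B \<longleftrightarrow> property_M B)"
proof -
  have "B = exchange_matrix B0 r"
    using assms(2) by (rule ext)
  then have "is_cluster_pattern B0 r B (cluster_variable B0 r)"
    using is_cluster_pattern_cluster_pattern[OF assms(1)] by simp
  then interpret matrix_pattern B
    by unfold_locales
      (auto simp: is_cluster_pattern_iff assms(2) skew_symmetrizable_exchange_matrix[OF assms(1)])
  show ?thesis
    using property_D_iff_property_R property_R_iff_property_M by blast
qed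

end
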